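(* (i) For $0 < x < 1$, $$\sum_{n=1}^\infty \frac{H_{n}^{(2)}}{n}x^{n}=-Li_{2}(x)\log(1-x)-\log(x)\log^{2}(1-x)-2\log(1-x)Li_{2}(1-x)+2Li_{3}(1-x)-2Li_{3}(1)+Li_{3}(x).$$ (ii) For $0 < x \le 1$, $$\sum_{n=1}^\infty \frac{H_{n}^{(2)}}{n}(-x)^{n}=-Li_{2}(-x)\log(1+x)-\log(x)\log^{2}(1+x)+\frac{2}{3}\log^{3}(1+x)+2\log(1+x)Li_{2}\Big(\frac{1}{1+x}\Big)+2Li_{3}\Big(\frac{1}{1+x}\Big)-2Li_{3}(1)+Li_{3}(-x).$$
   Context: $H_n^{(2)}=\sum_{j=1}^n 1/j^2$. $\log$ is the natural logarithm. For $p\in\mathbb{N}$ and real $|y|\le 1$, $Li_p(y)=\sum_{n\ge1} y^n/n^p$; $Li_p(1)=\zeta(p)$ for $p\ge2$. *)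

theory Defs
  imports "HOL-Analysis.Analysis"
begin

definition harm2 :: "nat \<Rightarrow> real" where
  "harm2 n = (\<Sum>j=1..n. 1 / real j ^ 2)"

(* Meaningful only where the series converges: for \<bar>y\<bar> \<le> 1 if p \<ge> 2, and for -1 \<le> y < 1 if p = 1. *)
definition Li :: "nat \<Rightarrow> real \<Rightarrow> real" where
  "Li p y = (\<Sum>n. y ^ Suc n / real (Suc n) ^ p)"

end

theory Submission
  imports Defs "HOL-Real_Asymp.Real_Asymp"
begin

text \<open>
  Write S(x) for the series of harm2 n / n x^n. Both sides of either identity have the same
  derivative on (0,1): termwise differentiation gives S'(x) = Li 2 x / (x (1 - x)), and on the
  right everything but Li 2 x / x + Li 2 x / (1 - x) cancels. Both sides tend to 0 as x tends to 0
  from the right. At x = 1 in the alternating case, harm2 n / n decreases to 0, so the Leibniz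
  remainder estimate is uniform on [0,1] and the identity extends by continuity.
\<close>

section \<open>Equality from derivatives, and power series with bounded coefficients\<close>

text \<open>The difference is constant on the connected interval, and the limit at \<open>0\<close>
  forces that constant to be \<open>0\<close>. Limits replace values at \<open>0\<close> because the
  closed forms contain \<open>ln x\<close>.\<close>

lemma eq_if_same_deriv_and_right_limit:
  fixes f g :: "real \<Rightarrow> real"
  assumes f: "\<And>x. 0 < x \<Longrightarrow> x < 1 \<Longrightarrow> (f has_real_derivative h x) (at x)"
    and g: "\<And>x. 0 < x \<Longrightarrow> x < 1 \<Longrightarrow> (g has_real_derivative h x) (at x)"
    and f0: "(f \<longlongrightarrow> l) (at_right 0)" and g0: "(g \<longlongrightarrow> l) (at_right 0)"
    and x: "0 < x" "x < 1"
  shows "f x = g x"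
proof -
  have "\<exists>c. \<forall>x\<in>{0<..<1}. f x - g x = c"
  proof (rule has_field_derivative_zero_constant)
    fix x :: real assume "x \<in> {0<..<1}"
    then have "((\<lambda>x. f x - g x) has_real_derivative (h x - h x)) (at x)"
      by (intro DERIV_diff f g) auto
    then show "((\<lambda>x. f x - g x) has_real_derivative 0) (at x within {0<..<1})"
      by (simp add: has_field_derivative_at_within)
  qed auto
  then obtain c where c: "\<And>x. x \<in> {0<..<1} \<Longrightarrow> f x - g x = c" by blast
  have "((\<lambda>x. f x - g x) \<longlongrightarrow> l - l) (at_right 0)"
    by (intro tendsto_diff f0 g0)
  moreover have "\<forall>\<^sub>F x in at_right 0. f x - g x = c"
    using eventually_at_right_real[of 0 1] by (rule eventually_mono) (auto intro: c)
  ultimately have "((\<lambda>_. c) \<longlongrightarrow> 0) (at_right (0::real))"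
    using Lim_transform_eventually by fastforce
  then have "c = 0"
    by (simp add: tendsto_const_iff)
  then show ?thesis using c[of x] x by simp
qed

lemma bounded_coeffs_powser_summable:
  fixes c :: "nat \<Rightarrow> real"
  assumes "\<And>n. \<bar>c n\<bar> \<le> C" "\<bar>x\<bar> < 1"
  shows "summable (\<lambda>n. c n * x ^ n)"
proof (rule summable_comparison_test')
  show "summable (\<lambda>n. C * \<bar>x\<bar> ^ n)"
    using assms by (intro summable_mult summable_geometric) auto
  show "norm (c n * x ^ n) \<le> C * \<bar>x\<bar> ^ n" if "n \<ge> 0" for n
    using assms(1)[of n] by (simp add: abs_mult power_abs mult_right_mono)
qed

text \<open>The bound puts the radius of convergence at 1 or more, so termwise differentiation
  applies to the full series minus \<open>c 0\<close>. Starting at exponent 1 matches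
  \<open>Li\<close> and \<open>harm2_series\<close>.\<close>

lemma bounded_coeffs_powser_Suc_deriv:
  fixes c :: "nat \<Rightarrow> real"
  assumes c: "\<And>n. \<bar>c n\<bar> \<le> C" and x: "\<bar>x\<bar> < 1"
  shows "((\<lambda>x. \<Sum>n. c (Suc n) * x ^ Suc n) has_real_derivative
           (\<Sum>n. real (Suc n) * c (Suc n) * x ^ n)) (at x)"
proof -
  have "((\<lambda>x. (\<Sum>n. c n * x ^ n) - c 0) has_real_derivative (\<Sum>n. diffs c n * x ^ n) - 0) (at x)"
    using x by (intro DERIV_diff termdiffs_strong'[where K = 1] bounded_coeffs_powser_summable[OF c])
      (auto intro!: derivative_eq_intros)
  then have "((\<lambda>x. (\<Sum>n. c n * x ^ n) - c 0) has_real_derivative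
      (\<Sum>n. real (Suc n) * c (Suc n) * x ^ n)) (at x)"
    by (simp add: diffs_def)
  \<comment> \<open>Splitting off the head needs convergence, hence \<open>y\<close> in the open
    unit interval; agreement near \<open>x\<close> is enough for the derivative.\<close>
  moreover have "\<forall>\<^sub>F y in nhds x. (\<Sum>n. c n * y ^ n) - c 0 = (\<Sum>n. c (Suc n) * y ^ Suc n)"
  proof -
    have "\<forall>\<^sub>F y in nhds x. y \<in> {-1<..<1}"
      using x by (intro eventually_nhds_in_open) auto
    then show ?thesis
    proof eventually_elim
      case (elim y)
      then show ?case
        using suminf_split_head[OF bounded_coeffs_powser_summable[of c C y, OF c]] by auto
    qed
  qed
  ultimately show ?thesis
    by (simp only: DERIV_cong_ev[OF refl _ refl])
qed

section \<open>Polylogarithms: derivatives and continuity up to the endpoints\<close>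

text \<open>Differentiation cancels one factor of the denominator and lowers the exponent of
  \<open>x\<close> by one. At \<open>0\<close> the formula would fail: the derivative is 1, while
  the quotient is \<open>0\<close> by convention.\<close>

lemma Li_deriv:
  assumes "\<bar>x\<bar> < 1" "x \<noteq> 0"
  shows "(Li (Suc p) has_real_derivative Li p x / x) (at x)"
proof -
  \<comment> \<open>At \<open>n = 0\<close> the coefficient is \<open>1 / 0 = 0\<close>, so the
    bound holds there too.\<close>
  have "\<bar>1 / real n ^ Suc p\<bar> \<le> 1" for n
    by (cases n) (auto simp: divide_simps intro!: one_le_power mult_ge1_I)
  from bounded_coeffs_powser_Suc_deriv[OF this assms(1)]
  have "((\<lambda>x. \<Sum>n. 1 / real (Suc n) ^ Suc p * x ^ Suc n) has_real_derivative
          (\<Sum>n. real (Suc n) * (1 / real (Suc n) ^ Suc p) * x ^ n)) (at x)" .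
  moreover have "(\<lambda>n. real (Suc n) * (1 / real (Suc n) ^ Suc p) * x ^ n) = (\<lambda>n. x ^ n / real (Suc n) ^ p)"
    by (auto simp del: of_nat_Suc)
  moreover have "(\<Sum>n. x ^ n / real (Suc n) ^ p) = Li p x / x"
  proof -
    have "summable (\<lambda>n. 1 / real (Suc n) ^ p * x ^ n)"
    proof (rule bounded_coeffs_powser_summable)
      show "\<bar>1 / real (Suc n) ^ p\<bar> \<le> 1" for n
        by (auto simp: divide_simps intro!: one_le_power)
    qed fact
    from suminf_mult[OF this, of x] show ?thesis
      using assms(2) by (simp add: Li_def field_simps)
  qed
  ultimately show ?thesis
    by (simp add: Li_def[abs_def])
qed

lemma Li_1:
  assumes "\<bar>x\<bar> < 1"
  shows "Li 1 x = - ln (1 - x)"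
proof -
  have "(\<lambda>n. - (x ^ n) / real n) sums ln (1 - x)"
    using ln_series'[of "- x"] assms by simp
  \<comment> \<open>The dropped term at index 0 is a division by zero, hence
    \<open>0\<close>.\<close>
  then have "(\<lambda>n. - (x ^ Suc n) / real (Suc n)) sums ln (1 - x)"
    by (subst sums_Suc_iff) simp
  then have "(\<lambda>n. x ^ Suc n / real (Suc n)) sums - ln (1 - x)"
    using sums_minus by fastforce
  then show ?thesis
    by (simp add: Li_def sums_iff)
qed

lemma Li_2_deriv:
  assumes "\<bar>x\<bar> < 1" "x \<noteq> 0"
  shows "(Li 2 has_real_derivative - ln (1 - x) / x) (at x)"
  using Li_deriv[OF assms, of 1] Li_1[OF assms(1)] by (simp add: numeral_2_eq_2)

lemma Li_3_deriv:
  assumes "\<bar>x\<bar> < 1" "x \<noteq> 0"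
  shows "(Li 3 has_real_derivative Li 2 x / x) (at x)"
  using Li_deriv[OF assms, of 2] by (simp add: numeral_3_eq_3)

lemma summable_inverse_Suc_power:
  assumes "p \<ge> 2"
  shows "summable (\<lambda>n. 1 / real (Suc n) ^ p)"
  using inverse_power_summable[OF assms, where ?'a = real]
  by (subst summable_Suc_iff) (simp add: inverse_eq_divide)

text \<open>Weierstrass test with majorant \<open>1 / real (Suc n) ^ p\<close>, summable since
  \<open>p \<ge> 2\<close>. Both endpoints are included because limits at arguments 1 and -1 occur
  later.\<close>

lemma continuous_on_Li:
  assumes "p \<ge> 2"
  shows "continuous_on {-1..1} (Li p)"
proof -
  have "uniform_limit {-1..1} (\<lambda>n y. \<Sum>i<n. y ^ Suc i / real (Suc i) ^ p)
          (\<lambda>y. \<Sum>i. y ^ Suc i / real (Suc i) ^ p) sequentially"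
  proof (rule Weierstrass_m_test[OF _ summable_inverse_Suc_power[OF assms]])
    fix n and y :: real assume "y \<in> {-1..1}"
    then have "\<bar>y\<bar> ^ Suc n \<le> 1"
      by (intro power_le_one) auto
    then show "norm (y ^ Suc n / real (Suc n) ^ p) \<le> 1 / real (Suc n) ^ p"
      by (simp add: power_abs abs_mult divide_right_mono)
  qed
  then show ?thesis
    unfolding Li_def[abs_def]
    by (rule uniform_limit_theorem[rotated]) (auto intro!: continuous_intros always_eventually)
qed

lemma tendsto_Li:
  assumes "p \<ge> 2" "(f \<longlongrightarrow> a) F" "\<bar>a\<bar> \<le> 1" "\<forall>\<^sub>F x in F. \<bar>f x\<bar> \<le> 1"
  shows "((\<lambda>x. Li p (f x)) \<longlongrightarrow> Li p a) F"
  using assms(3,4)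
  by (intro continuous_on_tendsto_compose[OF continuous_on_Li[OF assms(1)] assms(2)])
     (auto elim!: eventually_mono)

lemma Li_0 [simp]: "Li p 0 = 0"
  by (simp add: Li_def)

section \<open>The numbers \<open>harm2 n\<close> and their generating functions\<close>

lemma harm2_Suc: "harm2 (Suc n) = harm2 n + 1 / real (Suc n) ^ 2"
  by (simp add: harm2_def)

lemma harm2_nonneg: "0 \<le> harm2 n"
  by (simp add: harm2_def sum_nonneg)

text \<open>These are partial sums of a convergent series of nonnegative terms. The resulting
  uniform bound is what the power series lemmas require.\<close>

lemma harm2_le_Li_2_1: "harm2 n \<le> Li 2 1"
proof -
  have "harm2 n = (\<Sum>j<n. 1 / real (Suc j) ^ 2)"
    by (simp add: harm2_def sum.atLeast1_atMost_eq)
  also have "\<dots> \<le> (\<Sum>j. 1 / real (Suc j) ^ 2)"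
    by (intro sum_le_suminf summable_inverse_Suc_power) auto
  finally show ?thesis by (simp add: Li_def)
qed

lemma harm2_div_le: "\<bar>harm2 n / real n\<bar> \<le> Li 2 1"
proof (cases "n = 0")
  case False
  then have "harm2 n / real n \<le> harm2 n / 1"
    by (intro divide_left_mono) (auto simp: harm2_nonneg)
  then show ?thesis using harm2_le_Li_2_1[of n] harm2_nonneg[of n] by simp
qed (use harm2_nonneg[of 0] harm2_le_Li_2_1[of 0] in simp)

definition harm2_series :: "real \<Rightarrow> real" where
  "harm2_series x = (\<Sum>n. harm2 (Suc n) / real (Suc n) * x ^ Suc n)"

lemma harm2_series_sums:
  assumes "\<bar>x\<bar> < 1"
  shows "(\<lambda>n. harm2 (Suc n) / real (Suc n) * x ^ Suc n) sums harm2_series x"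
proof -
  have "summable (\<lambda>n. harm2 n / real n * x ^ n)"
    by (rule bounded_coeffs_powser_summable[OF harm2_div_le assms])
  then have "summable (\<lambda>n. harm2 (Suc n) / real (Suc n) * x ^ Suc n)"
    by (subst summable_Suc_iff)
  then show ?thesis
    by (simp add: harm2_series_def summable_sums)
qed

text \<open>Multiplying the generating function by \<open>1 - x\<close> takes differences of
  consecutive coefficients, which leaves the inverse squares.\<close>

lemma harm2_powser:
  assumes "\<bar>x\<bar> < 1" "x \<noteq> 0"
  shows "(\<Sum>n. harm2 (Suc n) * x ^ n) = Li 2 x / (x * (1 - x))"
proof -
  have bd: "\<bar>harm2 n\<bar> \<le> Li 2 1" for n
    using harm2_le_Li_2_1[of n] harm2_nonneg[of n] by simp
  define A where "A = (\<Sum>n. harm2 (Suc n) * x ^ n)"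
  have A: "(\<lambda>n. harm2 (Suc n) * x ^ n) sums A"
    unfolding A_def
    by (intro summable_sums bounded_coeffs_powser_summable[OF bd assms(1)])
  then have "(\<lambda>n. harm2 (Suc n) * x ^ Suc n) sums (x * A)"
    using sums_mult[OF A, of x] by (simp add: mult_ac)
  \<comment> \<open>This allows the shifted series to start at index 0 without changing its sum, so
    that it can be subtracted term by term.\<close>
  moreover have "harm2 0 = 0" by (simp add: harm2_def)
  ultimately have "(\<lambda>n. harm2 n * x ^ n) sums (x * A)"
    by (subst (asm) sums_Suc_iff) simp
  from sums_mult[OF sums_diff[OF A this], of x]
  have "(\<lambda>n. x ^ Suc n / real (Suc n) ^ 2) sums (x * (A - x * A))"
    by (simp add: harm2_Suc algebra_simps)
  then have "Li 2 x = x * (A - x * A)"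
    by (simp add: Li_def sums_iff)
  then show ?thesis
    using assms unfolding A_def[symmetric] by (simp add: field_simps)
qed

lemma harm2_series_deriv:
  assumes "\<bar>x\<bar> < 1" "x \<noteq> 0"
  shows "(harm2_series has_real_derivative Li 2 x / (x * (1 - x))) (at x)"
proof -
  have "(harm2_series has_real_derivative
          (\<Sum>n. real (Suc n) * (harm2 (Suc n) / real (Suc n)) * x ^ n)) (at x)"
    unfolding harm2_series_def[abs_def]
    by (rule bounded_coeffs_powser_Suc_deriv[OF harm2_div_le assms(1)])
  then show ?thesis
    using harm2_powser[OF assms] by (simp del: of_nat_Suc)
qed

text \<open>Continuity at \<open>0\<close> comes from the general power series lemma, as
  \<open>harm2_series_deriv\<close> excludes that point. The arbitrary \<open>f\<close> serves both
  \<open>x\<close> and \<open>- x\<close>.\<close>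

lemma tendsto_harm2_series_0:
  assumes "(f \<longlongrightarrow> 0) F"
  shows "((\<lambda>x. harm2_series (f x)) \<longlongrightarrow> 0) F"
proof -
  have "isCont harm2_series 0"
    unfolding harm2_series_def[abs_def]
    by (rule DERIV_isCont[OF bounded_coeffs_powser_Suc_deriv[OF harm2_div_le]]) simp
  from isCont_tendsto_compose[OF this assms] show ?thesis
    by (simp add: harm2_series_def)
qed

section \<open>Alternating power series on the closed interval\<close>

text \<open>Absolute convergence may fail at \<open>x = 1\<close>, so no summable majorant is at
  hand. The Leibniz remainder is bounded by \<open>a\<close> alone, independently of
  \<open>x\<close>.\<close>

lemma alternating_powser:
  fixes a :: "nat \<Rightarrow> real"
  assumes a0: "a \<longlonglongrightarrow> 0" and pos: "\<And>n. 0 \<le> a n" and mono: "\<And>n. a (Suc n) \<le> a n"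
  shows alternating_powser_summable:
      "\<And>x. x \<in> {0..1} \<Longrightarrow> summable (\<lambda>n. (-1) ^ n * (a n * x ^ n))"
    and continuous_on_alternating_powser:
      "continuous_on {0..1} (\<lambda>x. \<Sum>n. (-1) ^ n * (a n * x ^ n))"
proof -
  have *: "(\<lambda>n. a n * x ^ n) \<longlonglongrightarrow> 0" "\<And>n. 0 \<le> a n * x ^ n" "\<And>n. a n * x ^ n \<le> a n"
    "\<And>n. a (Suc n) * x ^ Suc n \<le> a n * x ^ n" if x: "x \<in> {0..1}" for x :: real
  proof -
    show nn: "0 \<le> a n * x ^ n" for n using x pos[of n] by simp
    show le: "a n * x ^ n \<le> a n" for n
      using x pos[of n] by (intro mult_left_le) (auto intro: power_le_one)
    show "a (Suc n) * x ^ Suc n \<le> a n * x ^ n" for n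
      using x pos[of n] mono[of n] by (intro mult_mono power_decreasing) auto
    show "(\<lambda>n. a n * x ^ n) \<longlonglongrightarrow> 0"
      by (rule tendsto_sandwich[OF _ _ tendsto_const a0]) (auto intro: nn le always_eventually)
  qed
  show "summable (\<lambda>n. (-1) ^ n * (a n * x ^ n))" if "x \<in> {0..1}" for x
    by (rule summable_Leibniz'(1)) (use *[OF that] in auto)
  let ?P = "\<lambda>n x. \<Sum>i<n. (-1) ^ i * (a i * x ^ i)"
  let ?S = "\<lambda>x. \<Sum>i. (-1) ^ i * (a i * x ^ i)"
  have est: "\<bar>?P (2 * n) x - ?S x\<bar> \<le> a (2 * n)" if "x \<in> {0..1}" for n x
  proof -
    \<comment> \<open>Even partial sums lie below the limit and odd ones above, so a single term
      bounds the error.\<close>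
    have "?P (2 * n) x \<le> ?S x" "?S x \<le> ?P (2 * n + 1) x"
      by (rule summable_Leibniz'(2,4); use *[OF that] in blast)+
    moreover have "?P (2 * n + 1) x = ?P (2 * n) x + a (2 * n) * x ^ (2 * n)"
      by simp
    ultimately show ?thesis using *(3)[OF that, of "2 * n"] by linarith
  qed
  have "uniform_limit {0..1} (\<lambda>n. ?P (2 * n)) ?S sequentially"
  proof (rule uniform_limitI)
    fix e :: real assume "e > 0"
    have "(\<lambda>n. a (2 * n)) \<longlonglongrightarrow> 0"
      using LIMSEQ_subseq_LIMSEQ[OF a0, of "\<lambda>n. 2 * n"]
      by (simp add: strict_mono_def o_def)
    then have "\<forall>\<^sub>F n in sequentially. a (2 * n) < e"
      using \<open>e > 0\<close> by (rule order_tendstoD)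
    then show "\<forall>\<^sub>F n in sequentially. \<forall>x\<in>{0..1}. dist (?P (2 * n) x) (?S x) < e"
      by eventually_elim (use est in \<open>fastforce simp: dist_real_def intro: le_less_trans\<close>)
  qed
  then show "continuous_on {0..1} ?S"
    by (rule uniform_limit_theorem[rotated]) (auto intro!: continuous_intros always_eventually)
qed

text \<open>With \<open>m = n + 1\<close>, clearing denominators reduces the claim to
  \<open>m / (m + 1) ^ 2 \<le> harm2 (Suc n)\<close>. The number 1 separates the two sides; on the
  right it is the summand \<open>j = 1\<close>.\<close>

lemma harm2_ratio_decseq: "harm2 (Suc (Suc n)) / real (Suc (Suc n)) \<le> harm2 (Suc n) / real (Suc n)"
proof -
  define m where "m = real (Suc n)"
  have m: "m \<ge> 1" "real (Suc (Suc n)) = m + 1" by (auto simp: m_def)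
  have "harm2 (Suc n) \<ge> 1"
    using sum_mono2[of "{1..Suc n}" "{1}" "\<lambda>j. 1 / real j ^ 2"] by (simp add: harm2_def)
  moreover have "m / (m + 1) ^ 2 \<le> 1"
    using m by (simp add: divide_simps power2_eq_square algebra_simps)
  ultimately have "m / (m + 1) ^ 2 \<le> harm2 (Suc n)" by linarith
  then have "m * (harm2 (Suc n) + 1 / (m + 1) ^ 2) \<le> (m + 1) * harm2 (Suc n)"
    by (simp add: algebra_simps)
  then have "(harm2 (Suc n) + 1 / (m + 1) ^ 2) / (m + 1) \<le> harm2 (Suc n) / m"
    using m by (simp add: pos_divide_le_eq pos_le_divide_eq mult.commute)
  then show ?thesis
    by (simp only: harm2_Suc[of "Suc n"] m(2) m_def[symmetric])
qed

lemma harm2_ratio_tendsto_0: "(\<lambda>n. harm2 (Suc n) / real (Suc n)) \<longlonglongrightarrow> 0"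
proof (rule tendsto_sandwich[OF _ _ tendsto_const])
  show "(\<lambda>n. Li 2 1 / real (Suc n)) \<longlonglongrightarrow> 0" by real_asymp
  show "\<forall>\<^sub>F n in sequentially. harm2 (Suc n) / real (Suc n) \<le> Li 2 1 / real (Suc n)"
    by (intro always_eventually allI divide_right_mono harm2_le_Li_2_1) auto
qed (auto intro!: always_eventually simp: harm2_nonneg)

lemma
  shows harm2_series_neg_sums:
      "\<And>x. x \<in> {0..1} \<Longrightarrow>
        (\<lambda>n. harm2 (Suc n) / real (Suc n) * (- x) ^ Suc n) sums harm2_series (- x)"
    and continuous_on_harm2_series_neg: "continuous_on {0..1} (\<lambda>x. harm2_series (- x))"
proof -
  let ?a = "\<lambda>n. harm2 (Suc n) / real (Suc n)"
  have pos: "0 \<le> ?a n" for n by (simp add: harm2_nonneg)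
  note alt = alternating_powser[OF harm2_ratio_tendsto_0 pos harm2_ratio_decseq]
  \<comment> \<open>Pulling out one factor \<open>- x\<close> aligns the exponent with the index, as
    \<open>alternating_powser\<close> expects.\<close>
  have eq: "(\<lambda>n. ?a n * (- x) ^ Suc n) = (\<lambda>n. - x * ((-1) ^ n * (?a n * x ^ n)))" for x :: real
    by (auto simp: power_minus[of x])
  show sums: "(\<lambda>n. ?a n * (- x) ^ Suc n) sums harm2_series (- x)" if "x \<in> {0..1}" for x
    unfolding harm2_series_def eq by (intro summable_sums summable_mult alt(1) that)
  have "harm2_series (- x) = - x * (\<Sum>n. (-1) ^ n * (?a n * x ^ n))" if "x \<in> {0..1}" for x
    unfolding harm2_series_def eq by (rule suminf_mult[OF alt(1)[OF that]])
  moreover have "continuous_on {0..1} (\<lambda>x. - x * (\<Sum>n. (-1) ^ n * (?a n * x ^ n)))"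
    by (intro continuous_on_mult alt(2) continuous_intros)
  ultimately show "continuous_on {0..1} (\<lambda>x. harm2_series (- x))"
    by (subst continuous_on_cong[OF refl]) auto
qed

section \<open>The two closed forms\<close>

lemma harm2_series_eq:
  assumes "0 < x" "x < 1"
  shows "harm2_series x = - Li 2 x * ln (1 - x) - ln x * (ln (1 - x))^2
    - 2 * ln (1 - x) * Li 2 (1 - x) + 2 * Li 3 (1 - x) - 2 * Li 3 1 + Li 3 x"
    (is "_ = ?R x")
proof (rule eq_if_same_deriv_and_right_limit[OF _ _ _ _ assms])
  fix x :: real assume x: "0 < x" "x < 1"
  show "(harm2_series has_real_derivative Li 2 x / (x * (1 - x))) (at x)"
    using x by (intro harm2_series_deriv) auto
  \<comment> \<open>Three pairs cancel: multiples of \<open>(ln (1 - x))^2 / x\<close>, of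
    \<open>ln x * ln (1 - x) / (1 - x)\<close> and of \<open>Li 2 (1 - x) / (1 - x)\<close>.\<close>
  show "(?R has_real_derivative Li 2 x / (x * (1 - x))) (at x)"
    using x
    by (auto intro!: derivative_eq_intros Li_2_deriv Li_3_deriv
          DERIV_chain2[OF Li_2_deriv] DERIV_chain2[OF Li_3_deriv])
       (simp add: divide_simps, simp add: algebra_simps power2_eq_square)
next
  show "(harm2_series \<longlongrightarrow> 0) (at_right 0)"
    by (rule tendsto_harm2_series_0) (auto intro: tendsto_eq_intros)
next
  have ev: "\<forall>\<^sub>F x in at_right 0. x \<in> {0<..<1::real}"
    by (rule eventually_at_right_real) simp
  have Li_x: "((\<lambda>x. Li p x) \<longlongrightarrow> Li p 0) (at_right 0)" if "p \<ge> 2" for p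
    using that by (intro tendsto_Li eventually_mono[OF ev]) auto
  have Li_1x: "((\<lambda>x. Li p (1 - x)) \<longlongrightarrow> Li p 1) (at_right 0)" if "p \<ge> 2" for p
    using that by (intro tendsto_Li eventually_mono[OF ev]) (auto intro!: tendsto_eq_intros)
  have L: "((\<lambda>x. ln (1 - x)) \<longlongrightarrow> 0) (at_right (0::real))" by real_asymp
  \<comment> \<open>The product is treated as a whole, since \<open>ln x\<close> alone has no finite
    limit; the square vanishes like \<open>x^2\<close> and wins.\<close>
  have LL: "((\<lambda>x. ln x * (ln (1 - x))^2) \<longlongrightarrow> 0) (at_right (0::real))" by real_asymp
  show "(?R \<longlongrightarrow> 0) (at_right 0)"
    by (rule LL L Li_x Li_1x tendsto_const tendsto_eq_intros | simp)+
qed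

text \<open>For \<open>x < 1\<close> the arguments \<open>- x\<close> and \<open>1 / (1 + x)\<close>
  have modulus below 1, as the derivative lemmas demand. At \<open>x = 1\<close> the argument
  \<open>- x\<close> reaches -1, so this case is a limit from the left.\<close>

lemma harm2_series_neg_eq:
  assumes "0 < x" "x \<le> 1"
  shows "harm2_series (- x) = - Li 2 (- x) * ln (1 + x) - ln x * (ln (1 + x))^2
    + 2 / 3 * (ln (1 + x))^3 + 2 * ln (1 + x) * Li 2 (1 / (1 + x)) + 2 * Li 3 (1 / (1 + x))
    - 2 * Li 3 1 + Li 3 (- x)"
    (is "_ = ?R x")
proof -
  have eq: "harm2_series (- x) = ?R x" if x: "0 < x" "x < 1" for x
  proof (rule eq_if_same_deriv_and_right_limit[OF _ _ _ _ x])
    fix x :: real assume x: "0 < x" "x < 1"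
    show "((\<lambda>x. harm2_series (- x)) has_real_derivative Li 2 (- x) / (x * (1 + x))) (at x)"
    proof -
      have "((\<lambda>x. harm2_series (- x)) has_real_derivative
              Li 2 (- x) / (- x * (1 - (- x))) * (- 1)) (at x)"
        using x by (intro DERIV_chain2[OF harm2_series_deriv]) (auto intro!: derivative_eq_intros)
      then show ?thesis by simp
    qed
    \<comment> \<open>This logarithm enters through the derivative of
      \<open>Li 2 (1 / (1 + x))\<close>, as \<open>1 - 1 / (1 + x) = x / (1 + x)\<close>. Its part
      \<open>- ln (1 + x)\<close> is what the cubic term of \<open>?R\<close> compensates.\<close>
    have ln: "ln (x / (1 + x)) = ln x - ln (1 + x)"
      using x by (simp add: ln_div)
    have [simp]: "1 + x \<noteq> 0" "\<bar>1 / (1 + x)\<bar> < 1" using x by auto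
    show "(?R has_real_derivative Li 2 (- x) / (x * (1 + x))) (at x)"
      using x
      by (auto intro!: derivative_eq_intros
            DERIV_chain2[OF Li_2_deriv] DERIV_chain2[OF Li_3_deriv])
         (simp add: ln divide_simps, simp add: algebra_simps power2_eq_square power3_eq_cube)
  next
    show "((\<lambda>x. harm2_series (- x)) \<longlongrightarrow> 0) (at_right 0)"
      by (rule tendsto_harm2_series_0) (auto intro!: tendsto_eq_intros)
  next
    have ev: "\<forall>\<^sub>F x in at_right 0. x \<in> {0<..<1::real}"
      by (rule eventually_at_right_real) simp
    have Li_x: "((\<lambda>x. Li p (- x)) \<longlongrightarrow> Li p 0) (at_right 0)" if "p \<ge> 2" for p
      using that by (intro tendsto_Li eventually_mono[OF ev]) (auto intro!: tendsto_eq_intros)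
    have Li_1x: "((\<lambda>x. Li p (1 / (1 + x))) \<longlongrightarrow> Li p 1) (at_right 0)" if "p \<ge> 2" for p
      using that by (intro tendsto_Li eventually_mono[OF ev]) (auto intro!: tendsto_eq_intros)
    have L: "((\<lambda>x. ln (1 + x)) \<longlongrightarrow> 0) (at_right (0::real))" by real_asymp
    have LL: "((\<lambda>x. ln x * (ln (1 + x))^2) \<longlongrightarrow> 0) (at_right (0::real))" by real_asymp
    show "(?R \<longlongrightarrow> 0) (at_right 0)"
      by (rule LL L Li_x Li_1x tendsto_const tendsto_eq_intros | simp)+
  qed
  \<comment> \<open>Both values are left limits at 1 of functions that agree on the open
    interval.\<close>
  have "harm2_series (- 1) = ?R 1"
  proof (rule tendsto_unique[OF trivial_limit_at_left_real])
    have ev: "\<forall>\<^sub>F x in at_left 1. x \<in> {0<..<1::real}"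
      by (rule eventually_at_left_real) simp
    show "((\<lambda>x. harm2_series (- x)) \<longlongrightarrow> harm2_series (- 1)) (at_left 1)"
      by (rule continuous_on_tendsto_compose[OF continuous_on_harm2_series_neg tendsto_ident_at])
         (auto intro: eventually_mono[OF ev])
    have Li_x: "((\<lambda>x. Li p (- x)) \<longlongrightarrow> Li p (- 1)) (at_left 1)" if "p \<ge> 2" for p
      using that by (intro tendsto_Li eventually_mono[OF ev]) (auto intro!: tendsto_eq_intros)
    have Li_1x: "((\<lambda>x. Li p (1 / (1 + x))) \<longlongrightarrow> Li p (1 / (1 + 1))) (at_left 1)" if "p \<ge> 2" for p
      using that by (intro tendsto_Li eventually_mono[OF ev]) (auto intro!: tendsto_eq_intros)
    have "(?R \<longlongrightarrow> ?R 1) (at_left 1)"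
      by (intro tendsto_intros Li_x Li_1x) auto
    then show "((\<lambda>x. harm2_series (- x)) \<longlongrightarrow> ?R 1) (at_left 1)"
      by (rule Lim_transform_eventually) (auto intro: eventually_mono[OF ev] simp: eq)
  qed
  then show ?thesis
    using eq[of x] assms by (cases "x = 1") auto
qed

theorem theorem3:
  shows "(\<forall>x::real. 0 < x \<and> x < 1 \<longrightarrow>
      (\<lambda>n. harm2 (Suc n) / real (Suc n) * x ^ Suc n) sums
        (- Li 2 x * ln (1 - x) - ln x * (ln (1 - x))^2 - 2 * ln (1 - x) * Li 2 (1 - x)
         + 2 * Li 3 (1 - x) - 2 * Li 3 1 + Li 3 x)) \<and>
    (\<forall>x::real. 0 < x \<and> x \<le> 1 \<longrightarrow>
      (\<lambda>n. harm2 (Suc n) / real (Suc n) * (- x) ^ Suc n) sums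
        (- Li 2 (- x) * ln (1 + x) - ln x * (ln (1 + x))^2 + 2 / 3 * (ln (1 + x))^3
         + 2 * ln (1 + x) * Li 2 (1 / (1 + x)) + 2 * Li 3 (1 / (1 + x))
         - 2 * Li 3 1 + Li 3 (- x)))"
proof (intro conjI allI impI; elim conjE)
  fix x :: real assume x: "0 < x" "x < 1"
  show "(\<lambda>n. harm2 (Suc n) / real (Suc n) * x ^ Suc n) sums
        (- Li 2 x * ln (1 - x) - ln x * (ln (1 - x))^2 - 2 * ln (1 - x) * Li 2 (1 - x)
         + 2 * Li 3 (1 - x) - 2 * Li 3 1 + Li 3 x)"
    \<comment> \<open>Once the closed form is folded back into \<open>harm2_series x\<close>, only
      convergence remains.\<close>
    unfolding harm2_series_eq[OF x, symmetric] using x by (intro harm2_series_sums) auto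
next
  fix x :: real assume x: "0 < x" "x \<le> 1"
  show "(\<lambda>n. harm2 (Suc n) / real (Suc n) * (- x) ^ Suc n) sums
        (- Li 2 (- x) * ln (1 + x) - ln x * (ln (1 + x))^2 + 2 / 3 * (ln (1 + x))^3
         + 2 * ln (1 + x) * Li 2 (1 / (1 + x)) + 2 * Li 3 (1 / (1 + x))
         - 2 * Li 3 1 + Li 3 (- x))"
    unfolding harm2_series_neg_eq[OF x, symmetric] using x by (intro harm2_series_neg_sums) auto
qed

end
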